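(* Consider the status-updating semi-Markov decision process described in the context with a reliable channel, $p_s=1$. Suppose $\frac{C(\boldsymbol a_1)}{L(\boldsymbol a_1)}\le\frac{C(\boldsymbol a_2)}{L(\boldsymbol a_2)}$. Then on $\mathcal S^\dagger$ there is an optimal policy $\pi^*$ of switch type: there is a threshold $\Omega\ge\min\{T_u,T_p+T_u'\}$ such that for $s\in\mathcal S^\dagger$ $$\pi^*(s)=\begin{cases}(0,0), & L(\boldsymbol a_1)\le s<\Omega,\\ \boldsymbol a_1, & s\ge\Omega.\end{cases}$$
   Context: Parameters: positive integers $T_u$ and $T_u'$ (sizes in packets of a status update before and after preprocessing; one packet is sent per minislot), positive reals $l$ (bits per packet), $v$ (CPU cycles per bit), $f$ (CPU frequency), $\tau$ (minislot length), $\kappa$, $P$, and a weighting factor $\omega>0$. Put $T_p=\lceil T_u l v/(f\tau)\rceil$, $C_p=\kappa\tau f^3$, $C_u=P\tau$. The packet success probability is $p_s=1$. Actions: $\mathcal A=\{(0,0),(0,1),(1,1)\}$ (idle; transmit directly; preprocess then transmit). Durations in minislots: $L((0,0))=1$, $L((0,1))=T_u$, $L((1,1))=T_p+T_u'$. Energies: $C((0,0))=0$, $C((0,1))=T_uC_u$, $C((1,1))=T_pC_p+T_u'C_u$. States: the age of information (AoI) $s\in\mathcal S=\{1,2,\dots,\hat\delta\}$, where the upper limit $\hat\delta$ is assumed finite but arbitrarily large. $\mathcal S^\dagger=\{\min\{T_u,T_p+T_u'\},\dots,\hat\delta\}$ (smaller states are non-recurrent). Transitions $p(\cdot\mid s,\boldsymbol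 a)$ (deterministic since $p_s=1$): under $(0,0)$ the next state is $\min(s+1,\hat\delta)$; under $\boldsymbol a\in\{(0,1),(1,1)\}$ it is $\min(L(\boldsymbol a),\hat\delta)$. Cost of a time step: $R(s,\boldsymbol a)=\frac12(2s+L(\boldsymbol a)-1)L(\boldsymbol a)+\omega C(\boldsymbol a)$. The objective is to minimize, over stationary deterministic policies (attention is restricted to unichain policies), the average cost $\limsup_{T\to\infty}\mathbb E[\sum_{t=1}^T R(s(t),\boldsymbol a(t))]/\mathbb E[\sum_{t=1}^T L(\boldsymbol a(t))]$. Equivalent discrete-time MDP: fix $\epsilon\in(0,\min_{\boldsymbol a}L(\boldsymbol a)]$, and set $\bar R(s,\boldsymbol a)=R(s,\boldsymbol a)/L(\boldsymbol a)$, $\bar p(s'\mid s,\boldsymbol a)=\frac{\epsilon}{L(\boldsymbol a)}p(s'\mid s,\boldsymbol a)$ for $s'\ne s$, and $\bar p(s\mid s,\boldsymbol a)=1-\frac{\epsilon}{L(\boldsymbol a)}+\frac{\epsilon}{L(\boldsymbol a)}p(s\mid s,\boldsymbol a)$. The optimal average cost $\theta$ and the value function $V$ satisfy $\theta+V(s)=\min_{\boldsymbol a\in\mathcal A}\{\bar R(s,\boldsymbol a)+\sum_{s'\in\mathcal S}\bar p(s'\mid s,\boldsymbol a)V(s')\}$ for all $s\in\mathcal S$, and an optimal policy $\pi^*$ is one for which $\pi^*(s)$ attains this minimum. $\boldsymbol a_1$ and $\boldsymbol a_2$ denote the two distinct elements of $\{(0,1),(1,1)\}$ with $L(\boldsymbol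 a_1)=\min$ and $L(\boldsymbol a_2)=\max$ of $L$ over $\{(0,1),(1,1)\}$. *)

theory Defs
  imports "HOL-Probability.Probability"
begin

record status_params =
  T_u :: nat          \<comment> \<open>update size before preprocessing, in packets\<close>
  T_u' :: nat         \<comment> \<open>update size after preprocessing, in packets\<close>
  pkt_bits :: real    \<comment> \<open>\<open>l\<close>, bits per packet\<close>
  cpu_cycles :: real  \<comment> \<open>\<open>v\<close>, CPU cycles per bit\<close>
  cpu_freq :: real    \<comment> \<open>\<open>f\<close>\<close>
  slot_len :: real    \<comment> \<open>\<open>\<tau>\<close>\<close>
  kappa :: real
  tx_power :: real    \<comment> \<open>\<open>P\<close>\<close>
  weight :: real      \<comment> \<open>\<open>\<omega>\<close>\<close>
  aoi_max :: nat      \<comment> \<open>the upper limit on the age of information\<close>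

definition valid_params :: "status_params \<Rightarrow> bool" where
  "valid_params M \<longleftrightarrow>
     0 < T_u M \<and> 0 < T_u' M \<and> 0 < pkt_bits M \<and> 0 < cpu_cycles M \<and> 0 < cpu_freq M \<and>
     0 < slot_len M \<and> 0 < kappa M \<and> 0 < tx_power M \<and> 0 < weight M \<and> 0 < aoi_max M"

definition T_p :: "status_params \<Rightarrow> nat" where
  "T_p M = nat \<lceil>real (T_u M) * pkt_bits M * cpu_cycles M / (cpu_freq M * slot_len M)\<rceil>"

definition C_p :: "status_params \<Rightarrow> real" where
  "C_p M = kappa M * slot_len M * cpu_freq M ^ 3"

definition C_u :: "status_params \<Rightarrow> real" where
  "C_u M = tx_power M * slot_len M"

type_synonym action = "nat \<times> nat"

text \<open>\<open>(0, 0)\<close>: idle; \<open>(0, 1)\<close>: transmit directly; \<open>(1, 1)\<close>: preprocess, then transmit.\<close>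

definition actions :: "action set" where
  "actions = {(0, 0), (0, 1), (1, 1)}"

definition duration :: "status_params \<Rightarrow> action \<Rightarrow> nat" where
  "duration M a =
     (if a = (0, 0) then 1 else if a = (0, 1) then T_u M else T_p M + T_u' M)"

definition energy :: "status_params \<Rightarrow> action \<Rightarrow> real" where
  "energy M a =
     (if a = (0, 0) then 0
      else if a = (0, 1) then real (T_u M) * C_u M
      else real (T_p M) * C_p M + real (T_u' M) * C_u M)"

definition states :: "status_params \<Rightarrow> nat set" where
  "states M = {1..aoi_max M}"

definition dagger_states :: "status_params \<Rightarrow> nat set" where
  "dagger_states M = {min (T_u M) (T_p M + T_u' M)..aoi_max M}"

text \<open>The kernel \<open>p(\<cdot> | s, a)\<close>; it is degenerate because every packet is received (\<open>p\<^sub>s = 1\<close>).\<close>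

definition trans_prob :: "status_params \<Rightarrow> nat \<Rightarrow> action \<Rightarrow> nat pmf" where
  "trans_prob M s a =
     return_pmf (if a = (0, 0) then min (s + 1) (aoi_max M) else min (duration M a) (aoi_max M))"

definition step_cost :: "status_params \<Rightarrow> nat \<Rightarrow> action \<Rightarrow> real" where
  "step_cost M s a =
     1 / 2 * (2 * real s + real (duration M a) - 1) * real (duration M a) + weight M * energy M a"

subsection \<open>Stationary deterministic policies and the average cost\<close>

definition policies :: "status_params \<Rightarrow> (nat \<Rightarrow> action) set" where
  "policies M = {\<pi>. \<forall>s\<in>states M. \<pi> s \<in> actions}"

text \<open>Law of the state after \<open>t\<close> decisions, started in \<open>s\<close>.\<close>

primrec state_dist :: "status_params \<Rightarrow> (nat \<Rightarrow> action) \<Rightarrow> nat \<Rightarrow> nat \<Rightarrow> nat pmf" where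
  "state_dist M \<pi> s 0 = return_pmf s"
| "state_dist M \<pi> s (Suc t) = bind_pmf (state_dist M \<pi> s t) (\<lambda>s'. trans_prob M s' (\<pi> s'))"

text \<open>The expectations of the sums are written as sums of expectations; the time steps
  \<open>1, \<dots>, T\<close> are numbered \<open>0, \<dots>, T - 1\<close>.\<close>

definition average_cost :: "status_params \<Rightarrow> (nat \<Rightarrow> action) \<Rightarrow> nat \<Rightarrow> ereal" where
  "average_cost M \<pi> s = limsup (\<lambda>T. ereal (
     (\<Sum>t<T. measure_pmf.expectation (state_dist M \<pi> s t) (\<lambda>s'. step_cost M s' (\<pi> s'))) /
     (\<Sum>t<T. measure_pmf.expectation (state_dist M \<pi> s t) (\<lambda>s'. real (duration M (\<pi> s'))))))"

definition policy_reach :: "status_params \<Rightarrow> (nat \<Rightarrow> action) \<Rightarrow> (nat \<times> nat) set" where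
  "policy_reach M \<pi> = {(s, s'). s \<in> states M \<and> s' \<in> set_pmf (trans_prob M s (\<pi> s))}\<^sup>*"

text \<open>In a finite chain, the recurrent classes are the sets of states reachable from a state
  to which every reachable state leads back.\<close>

definition recurrent_class :: "status_params \<Rightarrow> (nat \<Rightarrow> action) \<Rightarrow> nat set \<Rightarrow> bool" where
  "recurrent_class M \<pi> K \<longleftrightarrow>
     (\<exists>s\<in>states M. K = policy_reach M \<pi> `` {s} \<and> (\<forall>s'\<in>K. (s', s) \<in> policy_reach M \<pi>))"

definition unichain_policies :: "status_params \<Rightarrow> (nat \<Rightarrow> action) set" where
  "unichain_policies M = {\<pi> \<in> policies M. \<exists>!K. recurrent_class M \<pi> K}"

definition optimal_average_cost :: "status_params \<Rightarrow> real \<Rightarrow> bool" where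
  "optimal_average_cost M \<theta> \<longleftrightarrow>
     (\<forall>s\<in>states M. ereal \<theta> = (INF \<pi>\<in>unichain_policies M. average_cost M \<pi> s))"

subsection \<open>The equivalent discrete-time decision process\<close>

definition cost_bar :: "status_params \<Rightarrow> nat \<Rightarrow> action \<Rightarrow> real" where
  "cost_bar M s a = step_cost M s a / real (duration M a)"

text \<open>\<open>prob_bar M \<epsilon> s a s'\<close> is the probability of moving from \<open>s\<close> to \<open>s'\<close> under \<open>a\<close>.\<close>

definition prob_bar :: "status_params \<Rightarrow> real \<Rightarrow> nat \<Rightarrow> action \<Rightarrow> nat \<Rightarrow> real" where
  "prob_bar M \<epsilon> s a s' =
     (if s' = s
      then 1 - \<epsilon> / real (duration M a) + \<epsilon> / real (duration M a) * pmf (trans_prob M s a) s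
      else \<epsilon> / real (duration M a) * pmf (trans_prob M s a) s')"

definition bellman_rhs ::
    "status_params \<Rightarrow> real \<Rightarrow> (nat \<Rightarrow> real) \<Rightarrow> nat \<Rightarrow> action \<Rightarrow> real" where
  "bellman_rhs M \<epsilon> V s a = cost_bar M s a + (\<Sum>s'\<in>states M. prob_bar M \<epsilon> s a s' * V s')"

definition bellman_equation :: "status_params \<Rightarrow> real \<Rightarrow> real \<Rightarrow> (nat \<Rightarrow> real) \<Rightarrow> bool" where
  "bellman_equation M \<epsilon> \<theta> V \<longleftrightarrow>
     (\<forall>s\<in>states M. \<theta> + V s = (MIN a\<in>actions. bellman_rhs M \<epsilon> V s a))"

text \<open>\<open>V\<close> is existentially quantified because the equation determines it at best up to an
  additive constant.\<close>

definition optimal_policy :: "status_params \<Rightarrow> real \<Rightarrow> (nat \<Rightarrow> action) \<Rightarrow> bool" where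
  "optimal_policy M \<epsilon> \<pi> \<longleftrightarrow> \<pi> \<in> unichain_policies M \<and>
     (\<exists>\<theta> V. optimal_average_cost M \<theta> \<and> bellman_equation M \<epsilon> \<theta> V \<and>
        (\<forall>s\<in>states M. is_arg_min (bellman_rhs M \<epsilon> V s) (\<lambda>a. a \<in> actions) (\<pi> s)))"

end

theory Submission
  imports Defs
begin

text \<open>Since the chain is deterministic, it suffices to exhibit \<open>\<theta>\<close> and \<open>h = \<epsilon>V\<close> with
  \<open>h(s) = min\<^sub>a (R(s,a) - \<theta> L(a) + h(s'))\<close>; telescoping then shows that no policy averages below
  \<open>\<theta>\<close> and that a minimising one attains it. The longer transmission never helps, because
  transmitting \<open>a\<^sub>1\<close> and idling until the age is \<open>L(a\<^sub>2)\<close> takes the same time at no larger cost.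
  Between idling and \<open>a\<^sub>1\<close>, waiting one more slot at age \<open>k\<close> changes the relative cost by
  \<open>k + L(a\<^sub>1) - \<theta>\<close>, which increases in \<open>k\<close>, whence the threshold. If no cycle that transmits
  averages at most the cost of idling at the maximal age \<open>D\<close>, then \<open>\<theta> = D\<close> and the threshold
  lies beyond \<open>D\<close>.\<close>

section \<open>Deterministic trajectories under a policy\<close>

definition next_state :: "status_params \<Rightarrow> nat \<Rightarrow> action \<Rightarrow> nat" where
  "next_state M s a =
     (if a = (0, 0) then min (s + 1) (aoi_max M) else min (duration M a) (aoi_max M))"

lemma trans_prob_eq: "trans_prob M s a = return_pmf (next_state M s a)"
  by (simp add: trans_prob_def next_state_def)

lemma duration_pos:
  assumes "valid_params M"
  shows "0 < duration M a"
  using assms by (auto simp: valid_params_def duration_def)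

lemma energy_nonneg:
  assumes "valid_params M"
  shows "0 \<le> energy M a"
  using assms by (auto simp: valid_params_def energy_def C_u_def C_p_def)

lemma next_state_in_states:
  assumes "valid_params M"
  shows "next_state M s a \<in> states M"
  using assms duration_pos[OF assms, of a]
  by (auto simp: next_state_def states_def valid_params_def)

primrec trajectory :: "status_params \<Rightarrow> (nat \<Rightarrow> action) \<Rightarrow> nat \<Rightarrow> nat \<Rightarrow> nat" where
  "trajectory M \<pi> s 0 = s"
| "trajectory M \<pi> s (Suc t) = next_state M (trajectory M \<pi> s t) (\<pi> (trajectory M \<pi> s t))"

lemma state_dist_eq: "state_dist M \<pi> s t = return_pmf (trajectory M \<pi> s t)"
  by (induction t) (simp_all add: trans_prob_eq bind_return_pmf)

lemma trajectory_in_states: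
  assumes "valid_params M" "s \<in> states M"
  shows "trajectory M \<pi> s t \<in> states M"
  using assms by (cases t) (simp_all add: next_state_in_states)

lemma average_cost_eq:
  "average_cost M \<pi> s = limsup (\<lambda>T. ereal (
     (\<Sum>t<T. step_cost M (trajectory M \<pi> s t) (\<pi> (trajectory M \<pi> s t))) /
     (\<Sum>t<T. real (duration M (\<pi> (trajectory M \<pi> s t))))))"
  by (simp add: average_cost_def state_dist_eq)

lemma trajectory_duration_ge:
  assumes "valid_params M"
  shows "real T \<le> (\<Sum>t<T. real (duration M (\<pi> (trajectory M \<pi> s t))))"
proof -
  have "(\<Sum>t<T. (1::real)) \<le> (\<Sum>t<T. real (duration M (\<pi> (trajectory M \<pi> s t))))"
    by (rule sum_mono) (use duration_pos[OF assms] in \<open>simp add: Suc_le_eq\<close>)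
  thus ?thesis by simp
qed

section \<open>Bounds on the average cost by telescoping\<close>

text \<open>\<open>B\<close> stands for the boundary terms of a telescoping sum; as
  \<open>L T\<close> is at least \<open>T\<close>, its share \<open>B / L T\<close> vanishes in the
  limit.\<close>

lemma limsup_ratio_ge:
  fixes N L :: "nat \<Rightarrow> real"
  assumes L: "\<And>T. real T \<le> L T" and N: "\<And>T. \<theta> * L T - B \<le> N T" and B: "0 \<le> B"
  shows "ereal \<theta> \<le> limsup (\<lambda>T. ereal (N T / L T))"
proof -
  have bound: "\<theta> - B / real T \<le> N T / L T" if "1 \<le> T" for T
  proof -
    have LT: "0 < L T" using L[of T] that by linarith
    have "B / L T \<le> B / real T"
      using L[of T] B that LT by (intro divide_left_mono) auto
    moreover have "\<theta> - B / L T = (\<theta> * L T - B) / L T" using LT by (simp add: field_simps)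
    moreover have "\<dots> \<le> N T / L T" using N LT by (intro divide_right_mono) auto
    ultimately show ?thesis by linarith
  qed
  have "(\<lambda>T. \<theta> - B / real T) \<longlonglongrightarrow> \<theta> - 0"
    by (intro tendsto_intros lim_const_over_n)
  hence "limsup (\<lambda>T. ereal (\<theta> - B / real T)) = ereal \<theta>"
    by (intro lim_imp_Limsup) simp_all
  moreover have "limsup (\<lambda>T. ereal (\<theta> - B / real T)) \<le> limsup (\<lambda>T. ereal (N T / L T))"
    using bound by (intro Limsup_mono eventually_sequentiallyI[of 1]) auto
  ultimately show ?thesis by simp
qed

lemma limsup_ratio_le:
  fixes N L :: "nat \<Rightarrow> real"
  assumes L: "\<And>T. real T \<le> L T" and N: "\<And>T. N T \<le> \<theta> * L T + B" and B: "0 \<le> B"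
  shows "limsup (\<lambda>T. ereal (N T / L T)) \<le> ereal \<theta>"
proof -
  have bound: "N T / L T \<le> \<theta> + B / real T" if "1 \<le> T" for T
  proof -
    have LT: "0 < L T" using L[of T] that by linarith
    have "B / L T \<le> B / real T"
      using L[of T] B that LT by (intro divide_left_mono) auto
    moreover have "\<theta> + B / L T = (\<theta> * L T + B) / L T" using LT by (simp add: field_simps)
    moreover have "N T / L T \<le> (\<theta> * L T + B) / L T" using N LT by (intro divide_right_mono) auto
    ultimately show ?thesis by linarith
  qed
  have "(\<lambda>T. \<theta> + B / real T) \<longlonglongrightarrow> \<theta> + 0"
    by (intro tendsto_intros lim_const_over_n)
  hence "limsup (\<lambda>T. ereal (\<theta> + B / real T)) = ereal \<theta>"
    by (intro lim_imp_Limsup) simp_all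
  moreover have "limsup (\<lambda>T. ereal (N T / L T)) \<le> limsup (\<lambda>T. ereal (\<theta> + B / real T))"
    using bound by (intro Limsup_mono eventually_sequentiallyI[of 1]) auto
  ultimately show ?thesis by simp
qed

text \<open>Only finitely many states occur. The half makes \<open>B\<close> a bound for the
  difference of any two values.\<close>

lemma trajectory_values_bounded:
  fixes h :: "nat \<Rightarrow> real"
  assumes "valid_params M" "s \<in> states M"
  obtains B where "0 \<le> B" "\<And>t. \<bar>h (trajectory M \<pi> s t)\<bar> \<le> B / 2"
proof -
  have "\<bar>h (trajectory M \<pi> s t)\<bar> \<le> (\<Sum>s\<in>states M. \<bar>h s\<bar>)" for t
    by (rule member_le_sum[OF trajectory_in_states[OF assms], where f = "\<lambda>s. \<bar>h s\<bar>"])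
      (auto simp: states_def)
  thus ?thesis
    by (intro that[of "2 * (\<Sum>s\<in>states M. \<bar>h s\<bar>)"]) (simp_all add: sum_nonneg)
qed

text \<open>Summing the hypothesis along the trajectory telescopes \<open>h\<close>, so the total
  cost falls short of \<open>\<theta>\<close> times the total duration by at most a
  constant.\<close>

lemma average_cost_ge:
  fixes h :: "nat \<Rightarrow> real"
  assumes M: "valid_params M" and s: "s \<in> states M"
    and h: "\<And>s. s \<in> states M \<Longrightarrow>
              h s \<le> step_cost M s (\<pi> s) - \<theta> * real (duration M (\<pi> s)) + h (next_state M s (\<pi> s))"
  shows "ereal \<theta> \<le> average_cost M \<pi> s"
proof -
  define x where "x = trajectory M \<pi> s"
  obtain B where B: "0 \<le> B" "\<And>t. \<bar>h (x t)\<bar> \<le> B / 2"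
    using trajectory_values_bounded[OF M s] unfolding x_def by blast
  have tel: "h (x 0) - h (x T) \<le> (\<Sum>t<T. step_cost M (x t) (\<pi> (x t)))
      - \<theta> * (\<Sum>t<T. real (duration M (\<pi> (x t))))" for T
  proof (induction T)
    case (Suc T)
    thus ?case using h[OF trajectory_in_states[OF M s], of \<pi> T] by (simp add: x_def algebra_simps)
  qed simp
  have "\<theta> * (\<Sum>t<T. real (duration M (\<pi> (x t)))) - B \<le> (\<Sum>t<T. step_cost M (x t) (\<pi> (x t)))" for T
    using tel[of T] B(2)[of 0] B(2)[of T] by linarith
  thus ?thesis
    unfolding average_cost_eq x_def
    by (intro limsup_ratio_ge[OF _ _ B(1)] trajectory_duration_ge[OF M])
qed

lemma average_cost_le:
  fixes h :: "nat \<Rightarrow> real"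
  assumes M: "valid_params M" and s: "s \<in> states M"
    and h: "\<And>s. s \<in> states M \<Longrightarrow>
              step_cost M s (\<pi> s) - \<theta> * real (duration M (\<pi> s)) + h (next_state M s (\<pi> s)) \<le> h s"
  shows "average_cost M \<pi> s \<le> ereal \<theta>"
proof -
  define x where "x = trajectory M \<pi> s"
  obtain B where B: "0 \<le> B" "\<And>t. \<bar>h (x t)\<bar> \<le> B / 2"
    using trajectory_values_bounded[OF M s] unfolding x_def by blast
  have tel: "(\<Sum>t<T. step_cost M (x t) (\<pi> (x t))) - \<theta> * (\<Sum>t<T. real (duration M (\<pi> (x t))))
      \<le> h (x 0) - h (x T)" for T
  proof (induction T)
    case (Suc T)
    thus ?case using h[OF trajectory_in_states[OF M s], of \<pi> T] by (simp add: x_def algebra_simps)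
  qed simp
  have "(\<Sum>t<T. step_cost M (x t) (\<pi> (x t))) \<le> \<theta> * (\<Sum>t<T. real (duration M (\<pi> (x t)))) + B" for T
    using tel[of T] B(2)[of 0] B(2)[of T] by linarith
  thus ?thesis
    unfolding average_cost_eq x_def
    by (intro limsup_ratio_le[OF _ _ B(1)] trajectory_duration_ge[OF M])
qed

section \<open>The Bellman equation and unichain policies\<close>

lemma bellman_rhs_eq:
  assumes M: "valid_params M" and s: "s \<in> states M"
  shows "bellman_rhs M \<epsilon> V s a =
     cost_bar M s a + V s + \<epsilon> / real (duration M a) * (V (next_state M s a) - V s)"
proof -
  define q where "q = \<epsilon> / real (duration M a)"
  define n where "n = next_state M s a"
  have n: "n \<in> states M" using M by (simp add: n_def next_state_in_states)
  have fin: "finite (states M)" by (simp add: states_def)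
  \<comment> \<open>Two separate indicators also cover a self-loop: for \<open>n = s\<close> the
    masses \<open>1 - q\<close> and \<open>q\<close> add up.\<close>
  have "(\<Sum>s'\<in>states M. prob_bar M \<epsilon> s a s' * V s') =
      (\<Sum>s'\<in>states M. (if s' = s then (1 - q) * V s' else 0) + (if s' = n then q * V s' else 0))"
    by (intro sum.cong) (auto simp: prob_bar_def trans_prob_eq q_def n_def algebra_simps)
  also have "\<dots> = (1 - q) * V s + q * V n"
    using s n fin by (simp add: sum.distrib)
  finally show ?thesis
    by (simp add: bellman_rhs_def q_def n_def algebra_simps)
qed

text \<open>Ages are bounded, so a path that increases until it meets \<open>r\<close> must meet it.
  Hence every recurrent class contains \<open>r\<close> and equals the set reachable from
  \<open>r\<close>.\<close>

lemma unichain_if_common_target: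
  assumes M: "valid_params M" and \<pi>: "\<pi> \<in> policies M" and r: "r \<in> states M"
    and step: "\<And>s. s \<in> states M \<Longrightarrow> s \<noteq> r \<Longrightarrow>
                 next_state M s (\<pi> s) = r \<or> s < next_state M s (\<pi> s)"
  shows "\<pi> \<in> unichain_policies M"
proof -
  define E where "E = {(s, s'). s \<in> states M \<and> s' \<in> set_pmf (trans_prob M s (\<pi> s))}"
  have E: "policy_reach M \<pi> = E\<^sup>*" by (simp add: policy_reach_def E_def)
  have edge: "(s, next_state M s (\<pi> s)) \<in> E" if "s \<in> states M" for s
    using that by (simp add: E_def trans_prob_eq)
  have to_r: "(s, r) \<in> E\<^sup>*" if "s \<in> states M" for s
    using that
  proof (induction "aoi_max M - s" arbitrary: s rule: less_induct)
    case less
    show ?case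
    proof (cases "s = r")
      case False
      let ?n = "next_state M s (\<pi> s)"
      have n: "?n \<in> states M" using M by (rule next_state_in_states)
      have "(?n, r) \<in> E\<^sup>*"
      proof (cases "?n = r")
        case False
        hence "s < ?n" using step[OF less.prems \<open>s \<noteq> r\<close>] by simp
        thus ?thesis using less.hyps[of ?n] n by (auto simp: states_def)
      qed simp
      thus ?thesis using edge[OF less.prems] by (rule converse_rtrancl_into_rtrancl[rotated])
    qed simp
  qed
  have stay: "t \<in> states M" if "(s, t) \<in> E\<^sup>*" "s \<in> states M" for s t
    using that by (induction rule: rtrancl_induct)
      (auto simp: E_def trans_prob_eq next_state_in_states[OF M])
  have "\<exists>!K. recurrent_class M \<pi> K"
  proof (rule ex1I[of _ "E\<^sup>* `` {r}"])
    show "recurrent_class M \<pi> (E\<^sup>* `` {r})"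
      unfolding recurrent_class_def E using r to_r stay by blast
  next
    fix K assume "recurrent_class M \<pi> K"
    then obtain s where s: "s \<in> states M" "K = E\<^sup>* `` {s}" "\<forall>s'\<in>K. (s', s) \<in> E\<^sup>*"
      unfolding recurrent_class_def E by blast
    have "(s, r) \<in> E\<^sup>*" using to_r s(1) by simp
    moreover from this s have "(r, s) \<in> E\<^sup>*" by blast
    ultimately show "K = E\<^sup>* `` {r}"
      using s(2) by (auto intro: rtrancl_trans)
  qed
  thus ?thesis using \<pi> by (simp add: unichain_policies_def)
qed

text \<open>The hypotheses are the optimality equation of the semi-Markov process itself, free of
  \<open>\<epsilon>\<close>: \<open>le\<close> bounds every policy from below, \<open>eq\<close>
  makes \<open>\<pi>\<close> attain the bound.\<close>

lemma optimal_policyI: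
  fixes h :: "nat \<Rightarrow> real"
  assumes M: "valid_params M" and \<epsilon>: "0 < \<epsilon>" and \<pi>: "\<pi> \<in> unichain_policies M"
    and le: "\<And>s a. s \<in> states M \<Longrightarrow> a \<in> actions \<Longrightarrow>
              h s \<le> step_cost M s a - \<theta> * real (duration M a) + h (next_state M s a)"
    and eq: "\<And>s. s \<in> states M \<Longrightarrow>
              h s = step_cost M s (\<pi> s) - \<theta> * real (duration M (\<pi> s)) + h (next_state M s (\<pi> s))"
  shows "optimal_policy M \<epsilon> \<pi>"
proof -
  \<comment> \<open>Dividing by \<open>\<epsilon>\<close> cancels the \<open>\<epsilon>\<close> in
    the kernel. Each Bellman residual is then the semi-Markov residual over the duration, a positive
    factor that keeps signs and zeros.\<close>
  define V where "V s = h s / \<epsilon>" for s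
  have rhs: "bellman_rhs M \<epsilon> V s a = \<theta> + V s +
      (step_cost M s a - \<theta> * real (duration M a) + h (next_state M s a) - h s) / real (duration M a)"
    if "s \<in> states M" for s a
    using that \<epsilon> duration_pos[OF M, of a]
    by (simp add: bellman_rhs_eq[OF M] V_def cost_bar_def field_simps)
  have ge: "\<theta> + V s \<le> bellman_rhs M \<epsilon> V s a" if "s \<in> states M" "a \<in> actions" for s a
    using le[OF that] by (simp add: rhs that)
  have att: "bellman_rhs M \<epsilon> V s (\<pi> s) = \<theta> + V s" if "s \<in> states M" for s
    using eq[OF that] by (simp add: rhs that)
  have pol: "\<pi> \<in> policies M" using \<pi> by (simp add: unichain_policies_def)
  hence act: "\<pi> s \<in> actions" if "s \<in> states M" for s using that by (simp add: policies_def)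
  have "bellman_equation M \<epsilon> \<theta> V"
    unfolding bellman_equation_def
  proof
    fix s assume s: "s \<in> states M"
    have "finite actions" by (simp add: actions_def)
    thus "\<theta> + V s = (MIN a\<in>actions. bellman_rhs M \<epsilon> V s a)"
      using ge[OF s] att[OF s] act[OF s]
      by (intro Min_eqI[symmetric]) (auto intro!: image_eqI[where x = "\<pi> s"])
  qed
  moreover have "optimal_average_cost M \<theta>"
    unfolding optimal_average_cost_def
  proof (intro ballI antisym)
    fix s assume s: "s \<in> states M"
    show "ereal \<theta> \<le> (INF \<pi>\<in>unichain_policies M. average_cost M \<pi> s)"
      by (intro INF_greatest average_cost_ge[OF M s, where h = h] le)
        (auto simp: unichain_policies_def policies_def)
    show "(INF \<pi>\<in>unichain_policies M. average_cost M \<pi> s) \<le> ereal \<theta>"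
      using eq by (intro INF_lower2[OF \<pi>] average_cost_le[OF M s, where h = h]) simp
  qed
  moreover have "is_arg_min (bellman_rhs M \<epsilon> V s) (\<lambda>a. a \<in> actions) (\<pi> s)"
    if s: "s \<in> states M" for s
    using ge[OF s] att[OF s] act[OF s] by (force simp: is_arg_min_def not_less)
  ultimately show ?thesis
    unfolding optimal_policy_def using \<pi> by blast
qed

section \<open>The longer transmission is dominated\<close>

text \<open>After transmitting \<open>m\<close> packets one may idle until the age is \<open>n\<close>; this costs the same
  time as transmitting \<open>n\<close> packets at once, but the age \<open>s\<close> is shed earlier.\<close>

lemma longer_transmission_costs_more:
  fixes h :: "nat \<Rightarrow> real"
  assumes "\<theta> \<le> real D"
    and idle: "\<And>s. 1 \<le> s \<Longrightarrow> s < D \<Longrightarrow> h s \<le> real s - \<theta> + h (Suc s)"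
    and "1 \<le> m" "m \<le> n"
  shows "real m * real s + real m * (real m - 1) / 2 - \<theta> * real m + h (min m D)
       \<le> real n * real s + real n * (real n - 1) / 2 - \<theta> * real n + h (min n D)"
  using \<open>m \<le> n\<close>
proof (induction rule: dec_induct)
  case (step n)
  have "h (min n D) \<le> real n - \<theta> + h (min (Suc n) D)"
  proof (cases "n < D")
    case True
    thus ?thesis using idle[of n] step.hyps \<open>1 \<le> m\<close> by simp
  next
    \<comment> \<open>From \<open>D\<close> on, waiting keeps the capped state at \<open>D\<close>
      and costs \<open>n - \<theta>\<close>, which is nonnegative.\<close>
    case False
    thus ?thesis using \<open>\<theta> \<le> real D\<close> by (simp add: min_def)
  qed
  moreover have "0 \<le> real s" by simp
  moreover have "real (Suc n) * real s + real (Suc n) * (real (Suc n) - 1) / 2 - \<theta> * real (Suc n)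
      = (real n * real s + real n * (real n - 1) / 2 - \<theta> * real n) + real s + real n - \<theta>"
    by (simp add: field_simps)
  ultimately show ?case using step.IH by linarith
qed simp

lemma step_cost_eq:
  "step_cost M s a = real (duration M a) * real s
     + real (duration M a) * (real (duration M a) - 1) / 2 + weight M * energy M a"
  by (simp add: step_cost_def field_simps)

text \<open>With \<open>a2\<close> dominated by \<open>a1\<close>, the optimality equation need only
  be checked for idling and \<open>a1\<close>.\<close>

lemma optimal_policy_idle_or_short:
  fixes h :: "nat \<Rightarrow> real"
  assumes M: "valid_params M" and \<epsilon>: "0 < \<epsilon>"
    and a: "a1 \<noteq> (0, 0)" "a2 \<noteq> (0, 0)" "actions = {(0, 0), a1, a2}"
    and L: "duration M a1 \<le> duration M a2" and C: "energy M a1 \<le> energy M a2"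
    and \<theta>: "\<theta> \<le> real (aoi_max M)"
    and idle: "\<And>s. 1 \<le> s \<Longrightarrow> s < aoi_max M \<Longrightarrow> h s \<le> real s - \<theta> + h (Suc s)"
    and short: "\<And>s. 1 \<le> s \<Longrightarrow> s \<le> aoi_max M \<Longrightarrow>
       h s \<le> step_cost M s a1 - \<theta> * real (duration M a1) + h (next_state M s a1)"
    and \<pi>: "\<And>s. 1 \<le> s \<Longrightarrow> s \<le> aoi_max M \<Longrightarrow>
       \<pi> s = (0, 0) \<and> h s = real s - \<theta> + h (min (Suc s) (aoi_max M)) \<or>
       \<pi> s = a1 \<and> h s = step_cost M s a1 - \<theta> * real (duration M a1) + h (next_state M s a1)"
    and r: "r \<in> states M"
    and target: "\<And>s. s \<in> states M \<Longrightarrow> s \<noteq> r \<Longrightarrow>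
       next_state M s (\<pi> s) = r \<or> s < next_state M s (\<pi> s)"
  shows "optimal_policy M \<epsilon> \<pi>"
proof -
  have cost0: "step_cost M s (0, 0) - \<theta> * real (duration M (0, 0)) + h (next_state M s (0, 0))
      = real s - \<theta> + h (min (Suc s) (aoi_max M))" for s
    by (simp add: step_cost_def duration_def energy_def next_state_def)
  \<comment> \<open>At the maximal age idling is a self-loop of nonnegative relative cost, so the
    inequality extends to that age.\<close>
  have idle': "h s \<le> real s - \<theta> + h (min (Suc s) (aoi_max M))" if "s \<in> states M" for s
    using idle[of s] \<theta> that by (cases "s < aoi_max M") (auto simp: states_def min_def)
  have "weight M * energy M a1 \<le> weight M * energy M a2"
    using M C by (intro mult_left_mono) (auto simp: valid_params_def)
  moreover have "1 \<le> duration M a1" using duration_pos[OF M, of a1] by simp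
  ultimately have dom:
    "step_cost M s a1 - \<theta> * real (duration M a1) + h (next_state M s a1)
     \<le> step_cost M s a2 - \<theta> * real (duration M a2) + h (next_state M s a2)" for s
    using longer_transmission_costs_more[OF \<theta> idle, of "duration M a1" "duration M a2" s] a L
    by (simp add: step_cost_eq next_state_def)
  have pol: "\<pi> \<in> policies M"
    using \<pi> by (fastforce simp: policies_def a(3) states_def)
  show ?thesis
  proof (rule optimal_policyI[OF M \<epsilon> unichain_if_common_target[OF M pol r target]])
    fix s a assume s: "s \<in> states M" and "a \<in> actions"
    then consider "a = (0, 0)" | "a = a1" | "a = a2" by (auto simp: a(3))
    thus "h s \<le> step_cost M s a - \<theta> * real (duration M a) + h (next_state M s a)"
    proof cases
      case 1
      thus ?thesis using idle'[OF s] by (simp only: cost0)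
    next
      case 2
      thus ?thesis using short s by (simp add: states_def)
    next
      case 3
      have "h s \<le> step_cost M s a1 - \<theta> * real (duration M a1) + h (next_state M s a1)"
        using short s by (simp add: states_def)
      thus ?thesis using dom[of s] 3 by simp
    qed
  next
    fix s assume "s \<in> states M"
    hence "1 \<le> s" "s \<le> aoi_max M" by (simp_all add: states_def)
    from \<pi>[OF this] show
      "h s = step_cost M s (\<pi> s) - \<theta> * real (duration M (\<pi> s)) + h (next_state M s (\<pi> s))"
      using cost0[of s] by auto
  qed
qed

section \<open>Solutions of the optimality equation in two regimes\<close>

text \<open>The excess of the cheapest threshold cycle over the average \<open>\<theta>\<close>: idling at age \<open>k\<close> instead
  of transmitting at once changes the cost of a cycle by \<open>k + L - \<theta>\<close>, so the best policy idles
  where this is negative.\<close>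

definition cycle_excess :: "nat \<Rightarrow> nat \<Rightarrow> real \<Rightarrow> real \<Rightarrow> real" where
  "cycle_excess L D E \<theta> = real L * real L + real L * (real L - 1) / 2 + E - \<theta> * real L
     + (\<Sum>k = L..<D. min 0 (real k + real L - \<theta>))"

text \<open>The regime in which transmitting pays: \<open>\<theta>\<close> is the average at which
  the cheapest cycle has excess zero, found by the intermediate value theorem.\<close>

lemma threshold_values:
  fixes L D :: nat and E :: real
  assumes L: "L \<le> D" and E: "0 \<le> E" and ex: "cycle_excess L D E (real D) \<le> 0"
  obtains \<theta> and h :: "nat \<Rightarrow> real" where
    "\<theta> \<le> real D"
    "\<And>s. s < D \<Longrightarrow> h s \<le> real s - \<theta> + h (Suc s)"
    "\<And>s. s \<le> D \<Longrightarrow> h s \<le> real L * real s + real L * (real L - 1) / 2 + E - \<theta> * real L + h L"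
    "\<And>s. s < D \<Longrightarrow> real s + real L < \<theta> \<Longrightarrow> h s = real s - \<theta> + h (Suc s)"
    "\<And>s. s \<le> D \<Longrightarrow> s = D \<or> \<theta> \<le> real s + real L \<Longrightarrow>
       h s = real L * real s + real L * (real L - 1) / 2 + E - \<theta> * real L + h L"
proof -
  \<comment> \<open>For the sign change: at \<open>\<theta> = 0\<close> waiting never saves
    anything, so the excess is a nonnegative cycle cost; at \<open>D\<close> it is nonpositive by
    \<open>ex\<close>.\<close>
  have "0 \<le> real L * (real L - 1)" by (cases L) auto
  moreover have "(\<Sum>k = L..<D. min 0 (real k + real L - 0)) = 0" by (intro sum.neutral) auto
  ultimately have "0 \<le> cycle_excess L D E 0" using E by (simp add: cycle_excess_def)
  moreover have "continuous_on {0..real D} (cycle_excess L D E)"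
    unfolding cycle_excess_def[abs_def] by (intro continuous_intros)
  ultimately obtain \<theta> where \<theta>: "\<theta> \<le> real D" "cycle_excess L D E \<theta> = 0"
    using IVT2'[of "cycle_excess L D E" "real D" 0 0] ex by auto
  \<comment> \<open>\<open>g s\<close> is the total saved by waiting from age \<open>s\<close> as
    long as a further slot pays; \<open>L * s\<close> is the part of the transmission cost that
    depends on the age.\<close>
  define g where "g s = (\<Sum>k = s..<D. min 0 (real k + real L - \<theta>))" for s
  define h where "h s = real L * real s + g s" for s
  have g_step: "g s = min 0 (real s + real L - \<theta>) + g (Suc s)" if "s < D" for s
    using that by (simp add: g_def sum.atLeast_Suc_lessThan)
  have g_le: "g s \<le> 0" for s by (auto simp: g_def intro: sum_nonpos)
  have g_0: "g s = 0" if "s = D \<or> \<theta> \<le> real s + real L" "s \<le> D" for s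
    using that by (auto simp: g_def intro!: sum.neutral)
  \<comment> \<open>The root makes all constants cancel, so transmitting at \<open>s\<close> is
    worth exactly \<open>L * s\<close>.\<close>
  have tx: "real L * real s + real L * (real L - 1) / 2 + E - \<theta> * real L + h L = real L * real s" for s
    using \<theta>(2) by (simp add: cycle_excess_def h_def g_def)
  show ?thesis
  proof (rule that[of \<theta> h])
    show "h s \<le> real s - \<theta> + h (Suc s)" if "s < D" for s
      using g_step[OF that] by (simp add: h_def algebra_simps min_def split: if_splits)
    show "h s = real s - \<theta> + h (Suc s)" if "s < D" "real s + real L < \<theta>" for s
      using g_step[OF that(1)] that(2) by (simp add: h_def algebra_simps)
  qed (use \<theta> g_le g_0 in \<open>simp_all add: tx, simp_all add: h_def\<close>)
qed

text \<open>With average \<open>D\<close>, the self-loop of idling at \<open>D\<close> has relative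
  cost zero, and \<open>h\<close> is the least relative cost of getting there.\<close>

lemma idle_values:
  fixes L D :: nat and E :: real
  assumes E: "0 \<le> E" and ex: "L \<le> D \<Longrightarrow> 0 \<le> cycle_excess L D E (real D)"
  obtains h :: "nat \<Rightarrow> real" where
    "\<And>s. s < D \<Longrightarrow> h s \<le> real s - real D + h (Suc s)"
    "\<And>s. s \<le> D \<Longrightarrow>
       h s \<le> real L * real s + real L * (real L - 1) / 2 + E - real D * real L + h (min L D)"
    "\<And>s. s < D \<Longrightarrow> L \<le> s \<Longrightarrow> h s = real s - real D + h (Suc s)"
    "\<And>s. s < D \<Longrightarrow> h s \<noteq> real s - real D + h (Suc s) \<Longrightarrow>
       h s = real L * real s + real L * (real L - 1) / 2 + E - real D * real L + h (min L D)"
proof -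
  \<comment> \<open>\<open>H s\<close> is the relative cost of idling from \<open>s\<close> up to
    \<open>D\<close>; \<open>L * s + K\<close> is that of transmitting at \<open>s\<close> and
    idling ever after.\<close>
  define H where "H s = (\<Sum>k = s..<D. real k - real D)" for s
  define K where "K = real L * (real L - 1) / 2 + E - real D * real L + H (min L D)"
  \<comment> \<open>Below \<open>min L D\<close> transmitting may beat idling even though idling is optimal in the long
    run, so \<open>h\<close> is computed backwards from \<open>D\<close>, indexed by the distance to \<open>D\<close>.\<close>
  define w where "w = rec_nat (0::real)
    (\<lambda>j x. min (real (D - Suc j) - real D + x) (real L * real (D - Suc j) + K))"
  define h where "h s = w (D - s)" for s
  have L2: "0 \<le> real L * (real L - 1)" by (cases L) auto
  have h_D: "h D = 0" by (simp add: h_def w_def)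
  have h_step: "h s = min (real s - real D + h (Suc s)) (real L * real s + K)" if "s < D" for s
  proof -
    have "D - s = Suc (D - Suc s)" using that by simp
    moreover have "D - Suc (D - Suc s) = s" using that by simp
    ultimately show ?thesis unfolding h_def w_def by simp
  qed
  have H_step: "H s = real s - real D + H (Suc s)" if "s < D" for s
    using that by (simp add: H_def sum.atLeast_Suc_lessThan)
  \<comment> \<open>For \<open>L \<le> D\<close>, replacing the negative parts on
    \<open>L..<s\<close> by the full increments bounds the excess by that of the cycle transmitting
    at \<open>s\<close>. The latter is thus nonnegative, so idling on is no worse.\<close>
  have H_le: "H s \<le> real L * real s + K" if s: "min L D \<le> s" "s \<le> D" for s
  proof (cases "L \<le> D")
    case True
    with s have Ls: "L \<le> s" by simp
    have "(\<Sum>k = L..<D. min 0 (real k + real L - real D))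
        = (\<Sum>k = L..<s. min 0 (real k + real L - real D)) + (\<Sum>k = s..<D. min 0 (real k + real L - real D))"
      using Ls s by (simp add: sum.atLeastLessThan_concat)
    also have "\<dots> \<le> (\<Sum>k = L..<s. real k + real L - real D) + 0"
      by (intro add_mono sum_mono sum_nonpos) auto
    also have "\<dots> = (\<Sum>k = L..<s. real k - real D) + real L * (real s - real L)"
      using Ls by (simp add: sum.distrib sum_subtractf algebra_simps)
    also have "(\<Sum>k = L..<s. real k - real D) = H L - H s"
      using Ls s sum.atLeastLessThan_concat[of L s D "\<lambda>k. real k - real D"] by (simp add: H_def)
    finally show ?thesis using ex[OF True] True
      by (simp add: cycle_excess_def K_def algebra_simps)
  next
    case False
    with s have "s = D" by simp
    thus ?thesis using False L2 E by (simp add: K_def H_def)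
  qed
  \<comment> \<open>\<open>K\<close> was built from \<open>H (min L D)\<close>, while the value of
    transmitting involves \<open>h (min L D)\<close>; their agreement closes the circle.\<close>
  have h_H: "h s = H s" if "min L D \<le> s" "s \<le> D" for s
    using that
  proof (induction "D - s" arbitrary: s)
    case 0
    hence "s = D" by simp
    thus ?case by (simp add: h_D H_def)
  next
    case (Suc j)
    hence "s < D" "h (Suc s) = H (Suc s)" by auto
    thus ?case using h_step[of s] H_step[of s] H_le[of s] Suc.prems by simp
  qed
  have tx: "real L * real s + real L * (real L - 1) / 2 + E - real D * real L + h (min L D)
      = real L * real s + K" for s
    by (simp add: K_def h_H)
  show ?thesis
  proof (rule that[of h])
    show "h s \<le> real L * real s + real L * (real L - 1) / 2 + E - real D * real L + h (min L D)"
      if "s \<le> D" for s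
      using that h_step[of s] h_H[of D] H_le[of D] unfolding tx by (cases "s = D") auto
    show "h s \<le> real s - real D + h (Suc s)" if "s < D" for s
      unfolding h_step[OF that] by (rule min.cobounded1)
    show "h s = real s - real D + h (Suc s)" if "s < D" "L \<le> s" for s
      using that h_H[of s] h_H[of "Suc s"] H_step[of s] by simp
    show "h s = real L * real s + real L * (real L - 1) / 2 + E - real D * real L + h (min L D)"
      if "s < D" "h s \<noteq> real s - real D + h (Suc s)" for s
      unfolding tx using h_step[OF that(1)] that(2) by linarith
  qed
qed

section \<open>The optimal switch policy\<close>

theorem theorem4:
  fixes M :: status_params and \<epsilon> :: real and a1 a2 :: action
  assumes "valid_params M"
    and "0 < \<epsilon>" and "\<epsilon> \<le> real (MIN a\<in>actions. duration M a)"
    and "a1 \<in> {(0, 1), (1, 1)}" and "a2 \<in> {(0, 1), (1, 1)}" and "a1 \<noteq> a2"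
    and "duration M a1 = (MIN a\<in>{(0, 1), (1, 1)}. duration M a)"
    and "duration M a2 = (MAX a\<in>{(0, 1), (1, 1)}. duration M a)"
    and "energy M a1 / real (duration M a1) \<le> energy M a2 / real (duration M a2)"
  shows "\<exists>\<pi> \<Omega>. optimal_policy M \<epsilon> \<pi> \<and> \<Omega> \<ge> min (T_u M) (T_p M + T_u' M) \<and>
           (\<forall>s\<in>dagger_states M.
              (duration M a1 \<le> s \<and> s < \<Omega> \<longrightarrow> \<pi> s = (0, 0)) \<and>
              (\<Omega> \<le> s \<longrightarrow> \<pi> s = a1))"
proof -
  note M = assms(1)
  define D where "D = aoi_max M"
  define L where "L = duration M a1"
  define E where "E = weight M * energy M a1"
  have D: "1 \<le> D" using M by (simp add: valid_params_def D_def)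
  have L: "1 \<le> L" using duration_pos[OF M, of a1] by (simp add: L_def)
  have E: "0 \<le> E" using M energy_nonneg[OF M] by (simp add: E_def valid_params_def)
  have a: "a1 \<noteq> (0, 0)" "a2 \<noteq> (0, 0)" "actions = {(0, 0), a1, a2}"
    using assms(4-6) by (auto simp: actions_def)
  have L_eq: "L = min (T_u M) (T_p M + T_u' M)"
    using assms(7) by (simp add: L_def duration_def)
  have L12: "duration M a1 \<le> duration M a2"
    using assms(7,8) by simp
  \<comment> \<open>A smaller energy rate over a shorter duration gives a smaller total
    energy.\<close>
  have "energy M a1 = energy M a1 / real (duration M a1) * real (duration M a1)"
    using duration_pos[OF M, of a1] by simp
  also have "\<dots> \<le> energy M a2 / real (duration M a2) * real (duration M a2)"
    using assms(9) L12 energy_nonneg[OF M] by (intro mult_mono) auto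
  also have "\<dots> = energy M a2"
    using duration_pos[OF M, of a2] by simp
  finally have C12: "energy M a1 \<le> energy M a2" .
  note optimal = optimal_policy_idle_or_short[OF M assms(2) a L12 C12, folded D_def]
  have tx: "step_cost M s a1 - \<theta> * real (duration M a1) + h (next_state M s a1) =
      real L * real s + real L * (real L - 1) / 2 + E - \<theta> * real L + h (min L D)"
    for s \<theta> and h :: "nat \<Rightarrow> real"
    using a(1) by (simp add: step_cost_eq next_state_def L_def D_def E_def)
  show ?thesis
  \<comment> \<open>If \<open>L > D\<close>, a transmission lands on \<open>D\<close> and saves
    nothing over idling there, so this joins the idle regime.\<close>
  proof (cases "L \<le> D \<and> cycle_excess L D E (real D) \<le> 0")
    case True
    then obtain \<theta> and h :: "nat \<Rightarrow> real" where \<theta>: "\<theta> \<le> real D"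
      and h: "\<And>s. s < D \<Longrightarrow> h s \<le> real s - \<theta> + h (Suc s)"
        "\<And>s. s \<le> D \<Longrightarrow> h s \<le> real L * real s + real L * (real L - 1) / 2 + E - \<theta> * real L + h L"
        "\<And>s. s < D \<Longrightarrow> real s + real L < \<theta> \<Longrightarrow> h s = real s - \<theta> + h (Suc s)"
        "\<And>s. s \<le> D \<Longrightarrow> s = D \<or> \<theta> \<le> real s + real L \<Longrightarrow>
           h s = real L * real s + real L * (real L - 1) / 2 + E - \<theta> * real L + h L"
      using threshold_values[of L D E] E by blast
    \<comment> \<open>Idling pays while \<open>s + L < \<theta>\<close>, whence the ceiling; the cap
      forces transmission at \<open>D\<close>, where idling would keep the age.\<close>
    define W where "W = min D (nat \<lceil>\<theta> - real L\<rceil>)"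
    have W: "s < W \<longleftrightarrow> s < D \<and> real s + real L < \<theta>" for s
      unfolding W_def by (simp add: zless_nat_eq_int_zless less_ceiling_iff algebra_simps)
    define \<pi> where "\<pi> s = (if s < W then (0, 0) else a1)" for s
    have LD: "min L D = L" using True by simp
    have "optimal_policy M \<epsilon> \<pi>"
    proof (rule optimal[where r = L and h = h, OF \<theta>])
      fix s assume "s \<in> states M" "s \<noteq> L"
      thus "next_state M s (\<pi> s) = L \<or> s < next_state M s (\<pi> s)"
        using W[of s] LD a(1) by (auto simp: \<pi>_def next_state_def D_def L_def)
    next
      fix s assume "1 \<le> s" "s \<le> D"
      thus "\<pi> s = (0, 0) \<and> h s = real s - \<theta> + h (min (Suc s) D) \<or>
        \<pi> s = a1 \<and> h s = step_cost M s a1 - \<theta> * real (duration M a1) + h (next_state M s a1)"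
        unfolding tx LD using W[of s] h(3,4)[of s] by (auto simp: \<pi>_def min_def)
    qed (use L True h(1,2) in \<open>auto simp: tx LD, auto simp: states_def D_def\<close>)
    \<comment> \<open>Raising the threshold to \<open>L\<close> changes nothing at ages from
      \<open>L\<close> on.\<close>
    moreover have "\<forall>s\<in>dagger_states M. (duration M a1 \<le> s \<and> s < max W L \<longrightarrow> \<pi> s = (0, 0)) \<and>
                     (max W L \<le> s \<longrightarrow> \<pi> s = a1)"
      by (auto simp: \<pi>_def L_def)
    ultimately show ?thesis
      by (intro exI[of _ \<pi>] exI[of _ "max W L"]) (simp add: L_eq)
  next
    case False
    hence ex: "L \<le> D \<Longrightarrow> 0 \<le> cycle_excess L D E (real D)" by simp
    obtain h :: "nat \<Rightarrow> real" where
      h: "\<And>s. s < D \<Longrightarrow> h s \<le> real s - real D + h (Suc s)"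
        "\<And>s. s \<le> D \<Longrightarrow>
           h s \<le> real L * real s + real L * (real L - 1) / 2 + E - real D * real L + h (min L D)"
        "\<And>s. s < D \<Longrightarrow> L \<le> s \<Longrightarrow> h s = real s - real D + h (Suc s)"
        "\<And>s. s < D \<Longrightarrow> h s \<noteq> real s - real D + h (Suc s) \<Longrightarrow>
           h s = real L * real s + real L * (real L - 1) / 2 + E - real D * real L + h (min L D)"
      using idle_values[OF E ex] by blast
    \<comment> \<open>Ties go to idling, which confines \<open>a1\<close> to ages below
      \<open>L\<close>.\<close>
    define \<pi> where "\<pi> s = (if s < D \<and> h s \<noteq> real s - real D + h (Suc s) then a1 else (0, 0))" for s
    have "optimal_policy M \<epsilon> \<pi>"
    \<comment> \<open>A transmission occurs only below both \<open>L\<close> and \<open>D\<close>,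
      so it too raises the age, to \<open>min L D\<close>; every path climbs to
      \<open>D\<close>.\<close>
    proof (rule optimal[where r = D and h = h and \<theta> = "real D"])
      fix s assume s: "s \<in> states M" "s \<noteq> D"
      hence "s < D" by (simp add: states_def D_def)
      thus "next_state M s (\<pi> s) = D \<or> s < next_state M s (\<pi> s)"
        using h(3)[of s] a(1) by (auto simp: \<pi>_def next_state_def D_def L_def)
    next
      fix s assume "1 \<le> s" "s \<le> D"
      thus "\<pi> s = (0, 0) \<and> h s = real s - real D + h (min (Suc s) D) \<or>
        \<pi> s = a1 \<and> h s = step_cost M s a1 - real D * real (duration M a1) + h (next_state M s a1)"
        unfolding tx using h(4)[of s] by (cases "s = D") (auto simp: \<pi>_def)
    qed (use D h(1,2) in \<open>auto simp: tx, auto simp: states_def D_def\<close>)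
    \<comment> \<open>\<open>Suc D\<close> exceeds every state, so the clause for \<open>a1\<close>
      is vacuous; the maximum with \<open>L\<close> keeps the threshold admissible when
      \<open>L > D\<close>.\<close>
    moreover have "\<forall>s\<in>dagger_states M.
        (duration M a1 \<le> s \<and> s < max L (Suc D) \<longrightarrow> \<pi> s = (0, 0)) \<and>
        (max L (Suc D) \<le> s \<longrightarrow> \<pi> s = a1)"
      using h(3) by (auto simp: \<pi>_def dagger_states_def D_def L_def)
    ultimately show ?thesis
      by (intro exI[of _ \<pi>] exI[of _ "max L (Suc D)"]) (simp add: L_eq)
  qed
qed

end
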